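(* Let $n\ge 1$ and suppose that $\lambda\in\mathbb{C}$ is a Cremer number, i.e. $\lambda$ is not a root of unity, $|\lambda|=1$ and $\liminf_{m\to\infty}\sqrt[m]{|\lambda^m-1|}=0$. Then there exists a global biholomorphism $F:\mathbb{C}^{n+1}\to\mathbb{C}^{n+1}$ with $F(0)=0$ such that $\mathrm{Spec}(D_0F)=\{\lambda,1\}$, the algebraic multiplicity of the eigenvalue $1$ of $D_0F$ is equal to $1$, and $F$ has the finite orbits property in every set of the form $\mathbb{C}^n\times U$, where $U\subset\mathbb{C}$ is a bounded open set.
   Context: Let $F:U'\to V'$ be a biholomorphism between open subsets of $\mathbb{C}^{N}$ containing the origin, with $F(0)=0$. For $A\subset U'\cap V'$ and $p\in A$, the positive orbit of $p$ by $F$ in $A$ is $O^+_{F,A}(p)=\{F^j(p) : j\ge 0,\ F^k(p)\in A \text{ for all } 0\le k\le j\}$, the negative orbit is $O^-_{F,A}(p)=O^+_{F^{-1},A}(p)$, and the orbit is $O_{F,A}(p)=O^+_{F,A}(p)\cup O^-_{F,A}(p)$. $F$ has the finite orbits property in $A$ if $O_{F,A}(p)$ is a finite set for every $p\in A$. $\mathrm{Spec}(D_0F)$ is the set of eigenvalues of the differential $D_0F$ of $F$ at $0$. *)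

theory Defs
  imports
    "HOL-Analysis.Analysis"
    "HOL-Library.Numeral_Type"
    "HOL-Computational_Algebra.Polynomial"
begin

definition cremer_number :: "complex \<Rightarrow> bool" where
  "cremer_number l \<longleftrightarrow>
     (\<forall>m::nat. m \<ge> 1 \<longrightarrow> l ^ m \<noteq> 1) \<and> cmod l = 1 \<and>
     liminf (\<lambda>m::nat. ereal (root m (cmod (l ^ m - 1)))) = 0"

(* The derivative is real-linear in the library; being given by a complex matrix makes it
   complex-linear. *)
definition holomorphic_map_on ::
  "(complex ^ 'm::finite \<Rightarrow> complex ^ 'k::finite) \<Rightarrow> (complex ^ 'm) set \<Rightarrow> bool" where
  "holomorphic_map_on F U \<longleftrightarrow>
     open U \<and> (\<forall>z\<in>U. \<exists>A :: complex ^ 'm ^ 'k. (F has_derivative (\<lambda>h. A *v h)) (at z))"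

definition biholomorphism ::
  "(complex ^ 'm::finite \<Rightarrow> complex ^ 'm) \<Rightarrow> (complex ^ 'm) set \<Rightarrow> (complex ^ 'm) set \<Rightarrow> bool" where
  "biholomorphism F U V \<longleftrightarrow>
     bij_betw F U V \<and> holomorphic_map_on F U \<and> holomorphic_map_on (inv_into U F) V"

definition spectrum_op :: "(complex ^ 'm::finite \<Rightarrow> complex ^ 'm) \<Rightarrow> complex set" where
  "spectrum_op L = {c. \<exists>v. v \<noteq> 0 \<and> L v = c *s v}"

definition charpoly :: "complex ^ 'm ^ 'm::finite \<Rightarrow> complex poly" where
  "charpoly A = det (\<chi> i j. (if i = j then [:0, 1:] else 0) - [:A $ i $ j:])"

definition alg_multiplicity :: "(complex ^ 'm::finite \<Rightarrow> complex ^ 'm) \<Rightarrow> complex \<Rightarrow> nat" where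
  "alg_multiplicity L c = order c (charpoly (matrix L))"

definition pos_orbit :: "('a \<Rightarrow> 'a) \<Rightarrow> 'a set \<Rightarrow> 'a \<Rightarrow> 'a set" where
  "pos_orbit F A p = {(F ^^ j) p | j. \<forall>k\<le>j. (F ^^ k) p \<in> A}"

(* The first argument of the following constants is the domain of the biholomorphism, needed to
   form its inverse. The set A is meant to lie in U and in the image of U under F, so values of F
   and of its inverse outside their domains are never used. *)
definition neg_orbit :: "'a set \<Rightarrow> ('a \<Rightarrow> 'a) \<Rightarrow> 'a set \<Rightarrow> 'a \<Rightarrow> 'a set" where
  "neg_orbit U F A p = pos_orbit (inv_into U F) A p"

definition full_orbit :: "'a set \<Rightarrow> ('a \<Rightarrow> 'a) \<Rightarrow> 'a set \<Rightarrow> 'a \<Rightarrow> 'a set" where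
  "full_orbit U F A p = pos_orbit F A p \<union> neg_orbit U F A p"

definition finite_orbits_property :: "'a set \<Rightarrow> ('a \<Rightarrow> 'a) \<Rightarrow> 'a set \<Rightarrow> bool" where
  "finite_orbits_property U F A \<longleftrightarrow> (\<forall>p\<in>A. finite (full_orbit U F A p))"

(* The space of (n+1)-tuples is complex ^ ('n + 1) with n = CARD('n), so n >= 1 is automatic:
   the coordinates Inl i are the first n ones and Inr 1 is the last one. *)
definition cart_prod ::
  "(complex ^ 'n::finite) set \<Rightarrow> complex set \<Rightarrow> (complex ^ ('n + 1)) set" where
  "cart_prod A U = {z. (\<chi> i. z $ Inl i) \<in> A \<and> z $ Inr 1 \<in> U}"

end

theory Submission
  imports Defs
begin

text \<open>
  The map is \<open>F(z, w) = (l z, w + g z)\<close> with \<open>g\<close> a lacunary series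
  \<open>\<Sum>m. G m z\<close> whose term \<open>G m\<close> is \<open>m\<close>-homogeneous: a multiple of the
  \<open>m\<close>-th power of a single coordinate. The last coordinate of an orbit is \<open>w\<close> plus a
  Birkhoff sum of \<open>g\<close> over the rotation by \<open>l\<close>. If these sums are bounded by \<open>C\<close>
  along an infinite orbit, averaging them against the characters of the rotation gives
  \<open>|G m z| \<le> C |l^m - 1|\<close> for all \<open>m\<close>. Since \<open>l\<close> is a Cremer number, the
  coefficients, of size \<open>|l^m - 1|^(1/2)\<close> along a sparse set of exponents, decay fast enough
  for \<open>g\<close> to be entire, and still violate this bound unless \<open>z = 0\<close>, in which case the
  point is fixed. The inverse of \<open>F\<close> has the same form, with \<open>1/l\<close> in place of \<open>l\<close>.
\<close>

section \<open>Birkhoff sums of a power series over a rotation\<close>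

lemma abel_summation_twisted:
  fixes W :: "nat \<Rightarrow> complex"
  shows "(\<Sum>k<K. (W (Suc k) - W k) * v ^ k) = W K * v ^ K - W 0 + (1 - v) * (\<Sum>k<K. W (Suc k) * v ^ k)"
  by (induction K) (auto simp: algebra_simps)

lemma power_neq_of_not_root_of_unity:
  fixes u :: complex
  assumes "u \<noteq> 0" and nr: "\<And>m. m \<ge> 1 \<Longrightarrow> u ^ m \<noteq> 1" and "m \<noteq> p"
  shows "u ^ m \<noteq> u ^ p"
proof -
  have *: "u ^ a \<noteq> u ^ b" if "a < b" for a b :: nat
  proof
    assume "u ^ a = u ^ b"
    also have "u ^ b = u ^ a * u ^ (b - a)"
      using that by (simp flip: power_add)
    finally have "u ^ (b - a) = 1"
      using \<open>u \<noteq> 0\<close> by simp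
    then show False
      using nr[of "b - a"] that by simp
  qed
  show ?thesis
    using *[of m p] *[of p m] \<open>m \<noteq> p\<close> by (metis nat_neq_iff)
qed

lemma geometric_average_tendsto_0:
  fixes q :: complex
  assumes "cmod q = 1" "q \<noteq> 1"
  shows "(\<lambda>K. (\<Sum>k<K. q ^ k) / of_nat K) \<longlonglongrightarrow> 0"
proof (rule Lim_null_comparison)
  show "\<forall>\<^sub>F K in sequentially. cmod ((\<Sum>k<K. q ^ k) / of_nat K) \<le> 2 / cmod (q - 1) / real K"
  proof (rule always_eventually, rule allI)
    fix K
    have "cmod (q ^ K - 1) \<le> 2"
      using norm_triangle_ineq4[of "q ^ K" 1] assms by (simp add: norm_power)
    moreover have "(\<Sum>k<K. q ^ k) = (q ^ K - 1) / (q - 1)"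
      using geometric_sum[OF assms(2)] by simp
    ultimately have "cmod (\<Sum>k<K. q ^ k) \<le> 2 / cmod (q - 1)"
      by (simp add: norm_divide divide_right_mono)
    then show "cmod ((\<Sum>k<K. q ^ k) / of_nat K) \<le> 2 / cmod (q - 1) / real K"
      unfolding norm_divide norm_of_nat by (rule divide_right_mono) simp
  qed
  show "(\<lambda>K. 2 / cmod (q - 1) / real K) \<longlonglongrightarrow> 0"
    by (rule lim_const_over_n)
qed

text \<open>Let v = u^(-p). The averages over k < K of (W (k+1) - W k) v^k are computed in two ways.
  In the series, term m acquires the average of (u^m v)^k, which is 1 for m = p and tends to 0
  otherwise, so the limit is \<open>G p\<close>. Summation by parts bounds the same averages by 2C/K
  + C |u^p - 1|.\<close>

lemma bounded_birkhoff_sums_coeff_bound: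
  fixes u :: complex and G W :: "nat \<Rightarrow> complex"
  assumes u: "cmod u = 1" and nr: "\<And>m. m \<ge> 1 \<Longrightarrow> u ^ m \<noteq> 1"
    and sm: "summable (\<lambda>m. cmod (G m))"
    and rec: "\<And>k. W (Suc k) - W k = (\<Sum>m. G m * (u ^ k) ^ m)"
    and bd: "\<And>k. cmod (W k) \<le> C"
  shows "cmod (G p) \<le> C * cmod (u ^ p - 1)"
proof -
  have u0: "u \<noteq> 0" using u by auto
  define v where "v = inverse (u ^ p)"
  have v: "cmod v = 1" using u by (simp add: v_def norm_inverse norm_power)
  have one_v: "cmod (1 - v) = cmod (u ^ p - 1)"
  proof -
    have "u ^ p - 1 = u ^ p * (1 - v)"
      using u0 by (simp add: v_def field_simps)
    then show ?thesis
      using u by (simp add: norm_mult norm_power)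
  qed
  define avg where "avg K m = (\<Sum>k<K. (u ^ m * v) ^ k) / of_nat K" for K m :: nat
  have avg_le: "cmod (avg K m) \<le> 1" for K m
  proof -
    have "cmod (\<Sum>k<K. (u ^ m * v) ^ k) \<le> (\<Sum>k<K. 1)"
      by (rule sum_norm_le) (simp add: norm_power norm_mult u v)
    then show ?thesis
      by (cases "K = 0") (auto simp: avg_def norm_divide)
  qed
  have lim: "(\<lambda>K. G m * avg K m) \<longlonglongrightarrow> (if m = p then G m else 0)" for m
  proof (cases "m = p")
    case True
    \<comment> \<open>For K = 0 the average is 0, by division by zero, so equality starts at K =
      1.\<close>
    have "\<forall>\<^sub>F K in sequentially. G m * avg K m = G m"
      using eventually_gt_at_top[of 0]
      by eventually_elim (use True u0 in \<open>simp add: avg_def v_def\<close>)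
    then show ?thesis
      using True by (auto intro: tendsto_eventually)
  next
    case False
    then have "u ^ m * v \<noteq> 1"
      using power_neq_of_not_root_of_unity[OF u0 nr] u0 by (simp add: v_def field_simps)
    moreover have "cmod (u ^ m * v) = 1"
      using u v by (simp add: norm_mult norm_power)
    ultimately have "(\<lambda>K. avg K m) \<longlonglongrightarrow> 0"
      unfolding avg_def by (intro geometric_average_tendsto_0)
    then show ?thesis
      using False by (auto intro: tendsto_mult_right_zero)
  qed
  have "cmod (G m * avg K m) \<le> cmod (G m)" for m K
    using mult_left_le[OF avg_le norm_ge_zero] by (simp add: norm_mult)
  then have "\<forall>\<^sub>F (m, K) in sequentially \<times>\<^sub>F sequentially. cmod (G m * avg K m) \<le> cmod (G m)"
    by (intro always_eventually) simp
  then have tannery: "(\<lambda>K. \<Sum>m. G m * avg K m) \<longlonglongrightarrow> (\<Sum>m. if m = p then G m else 0)"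
    using tannerys_theorem[OF lim _ sm] by simp
  have "(\<Sum>m. if m = p then G m else 0) = G p"
    using sums_single[of p G] by (simp add: sums_iff)
  with tannery have L: "(\<lambda>K. \<Sum>m. G m * avg K m) \<longlonglongrightarrow> G p" by simp
  have avg_eq: "(\<Sum>m. G m * avg K m) = (\<Sum>k<K. (W (Suc k) - W k) * v ^ k) / of_nat K" for K
  proof -
    have S: "summable (\<lambda>m. G m * (u ^ k) ^ m)" for k
      by (rule summable_norm_cancel) (use sm in \<open>simp add: norm_mult norm_power u\<close>)
    have "(\<Sum>k<K. (W (Suc k) - W k) * v ^ k) / of_nat K
        = (\<Sum>k<K. \<Sum>m. G m * (u ^ k) ^ m * v ^ k / of_nat K)"
      unfolding rec sum_divide_distrib
      by (intro sum.cong refl) (simp add: suminf_mult2[OF S] suminf_divide summable_mult2[OF S])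
    also have "\<dots> = (\<Sum>m. \<Sum>k<K. G m * (u ^ k) ^ m * v ^ k / of_nat K)"
      by (intro suminf_sum[symmetric] summable_divide summable_mult2 S)
    also have "\<dots> = (\<Sum>m. G m * avg K m)"
      by (simp add: avg_def sum_distrib_left sum_divide_distrib power_mult_distrib mult_ac
          flip: power_mult)
    finally show ?thesis by simp
  qed
  have C0: "C \<ge> 0" using bd[of 0] by (rule order_trans[OF norm_ge_zero])
  have bound: "cmod (\<Sum>m. G m * avg K m) \<le> 2 * C / real K + C * cmod (u ^ p - 1)" if "K > 0" for K
  proof -
    \<comment> \<open>After division by K the boundary terms, at most 2C, die out; the remaining sum
      is of order K C, so its factor |1 - v| = |u^p - 1| survives in the limit.\<close>
    have "cmod (\<Sum>k<K. W (Suc k) * v ^ k) \<le> (\<Sum>k<K. C)"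
      by (rule sum_norm_le) (simp add: norm_mult norm_power v bd)
    then have "cmod ((1 - v) * (\<Sum>k<K. W (Suc k) * v ^ k)) \<le> cmod (u ^ p - 1) * (real K * C)"
      by (simp add: norm_mult one_v mult_left_mono)
    moreover have "cmod (W K * v ^ K - W 0) \<le> C + C"
      using norm_triangle_ineq4[of "W K * v ^ K" "W 0"] bd[of K] bd[of 0]
      by (simp add: norm_mult norm_power v)
    ultimately have "cmod (\<Sum>k<K. (W (Suc k) - W k) * v ^ k) \<le> C + C + cmod (u ^ p - 1) * (real K * C)"
      unfolding abel_summation_twisted by (rule norm_triangle_mono[rotated])
    then show ?thesis
      using that by (simp add: avg_eq norm_divide field_simps)
  qed
  have "(\<lambda>K. 2 * C / real K + C * cmod (u ^ p - 1)) \<longlonglongrightarrow> 0 + C * cmod (u ^ p - 1)"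
    by (rule tendsto_add[OF lim_const_over_n tendsto_const])
  moreover have "\<exists>N. \<forall>K\<ge>N. cmod (\<Sum>m. G m * avg K m) \<le> 2 * C / real K + C * cmod (u ^ p - 1)"
    using bound by (intro exI[of _ 1]) simp
  ultimately have "cmod (G p) \<le> 0 + C * cmod (u ^ p - 1)"
    by (rule LIMSEQ_le[OF tendsto_norm[OF L]])
  then show ?thesis by simp
qed

section \<open>Lacunary coefficients from the Cremer condition\<close>

lemma cremer_number_subsequence:
  assumes "cremer_number l"
  obtains M :: "nat \<Rightarrow> nat" where "strict_mono M" "M 0 \<ge> 2"
    "\<And>k. cmod (l ^ M k - 1) < (1 / real (Suc k)) ^ (2 * M k)"
proof -
  have inf: "\<exists>m\<ge>N. cmod (l ^ m - 1) < e ^ m" if "e > 0" for e :: real and N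
  proof (rule ccontr)
    assume "\<not> ?thesis"
    then have *: "e ^ m \<le> cmod (l ^ m - 1)" if "m \<ge> N" for m
      using that by (auto simp: not_less)
    \<comment> \<open>Since \<open>root 0\<close> is constantly 0, the exponent 0 is excluded by
      \<open>max N 1\<close>.\<close>
    have "\<forall>\<^sub>F m in sequentially. ereal e \<le> ereal (root m (cmod (l ^ m - 1)))"
      using eventually_ge_at_top[of "max N 1"]
    proof eventually_elim
      case (elim m)
      then have "e = root m (e ^ m)" using that by (simp add: real_root_power_cancel)
      also have "\<dots> \<le> root m (cmod (l ^ m - 1))"
        using elim * by (intro real_root_le_mono) auto
      finally show ?case by simp
    qed
    then have "ereal e \<le> liminf (\<lambda>m. ereal (root m (cmod (l ^ m - 1))))"
      by (rule Liminf_bounded)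
    then show False
      using assms that by (simp add: cremer_number_def)
  qed
  \<comment> \<open>The exponent \<open>2 * M k\<close> is chosen so that even the square root of
    |l^m - 1| stays below (1/(k+1))^m at m = \<open>M k\<close>.\<close>
  have "\<exists>M. \<forall>k. (M k \<ge> 2 \<and> cmod (l ^ M k - 1) < (1 / real (Suc k)) ^ (2 * M k)) \<and> M k < M (Suc k)"
  proof (rule dependent_nat_choice)
    show "\<exists>x\<ge>2. cmod (l ^ x - 1) < (1 / real (Suc 0)) ^ (2 * x)"
      using inf[of 1 2] by auto
    fix x n :: nat
    show "\<exists>y. (y \<ge> 2 \<and> cmod (l ^ y - 1) < (1 / real (Suc (Suc n))) ^ (2 * y)) \<and> x < y"
    proof -
      obtain y where "y \<ge> max 2 (Suc x)" "cmod (l ^ y - 1) < ((1 / real (Suc (Suc n)))\<^sup>2) ^ y"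
        using inf[of "(1 / real (Suc (Suc n)))\<^sup>2" "max 2 (Suc x)"] by auto
      then show ?thesis
        unfolding power_mult by (intro exI[of _ y]) auto
    qed
  qed
  then obtain M where "\<forall>k. (M k \<ge> 2 \<and> cmod (l ^ M k - 1) < (1 / real (Suc k)) ^ (2 * M k)) \<and> M k < M (Suc k)"
    by blast
  then show ?thesis
    by (intro that[of M]) (auto simp: strict_mono_Suc_iff)
qed

text \<open>Coefficients of size |l^m - 1|^(1/2) meet two opposite demands along the sparse
  exponents: they decay faster than every geometric sequence, yet their quotients by |l^m - 1| grow
  faster than every geometric sequence, which defeats any C once some coordinate of z is nonzero.
  Vanishing in degrees 0 and 1, secured by \<open>M 0 \<ge> 2\<close>, serves to fix the origin and
  to make the differential there diagonal.\<close>

lemma cremer_number_lacunary_coefficients: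
  assumes "cremer_number l"
  obtains a :: "'n::finite \<Rightarrow> nat \<Rightarrow> complex" where
    "\<And>i y. summable (\<lambda>m. a i m * y ^ m)" "\<And>i. a i 0 = 0" "\<And>i. a i 1 = 0"
    "\<And>z C. \<forall>m. cmod (\<Sum>i\<in>UNIV. a i m * z i ^ m) \<le> C * cmod (l ^ m - 1) \<Longrightarrow> z = (\<lambda>_. 0)"
proof -
  obtain M where M: "strict_mono M" "M 0 \<ge> 2"
    and small: "\<And>k. cmod (l ^ M k - 1) < (1 / real (Suc k)) ^ (2 * M k)"
    by (rule cremer_number_subsequence[OF assms]) (rule that)
  have M2: "M k \<ge> 2" for k
    using M strict_mono_less_eq[of M 0 k] by auto
  have Mk: "M k \<ge> k" for k
    using M(1) by (rule strict_mono_imp_increasing)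
  have M_inj: "M j = M k \<longleftrightarrow> j = k" for j k
    using M(1) by (simp add: strict_mono_eq)
  have pos: "cmod (l ^ M k - 1) > 0" for k
    using assms M2[of k] by (auto simp: cremer_number_def)
  define s where "s m = sqrt (cmod (l ^ m - 1))" for m
  have s_pos: "s (M k) > 0" for k
    using pos by (simp add: s_def)
  have s_sq: "cmod (l ^ m - 1) = s m * s m" for m
    by (simp add: s_def)
  have s_small: "s (M k) \<le> (1 / real (Suc k)) ^ M k" for k
  proof -
    have "s (M k) \<le> sqrt ((1 / real (Suc k)) ^ (2 * M k))"
      unfolding s_def using small[of k] by (intro real_sqrt_le_mono) simp
    also have "(1 / real (Suc k)) ^ (2 * M k) = ((1 / real (Suc k)) ^ M k)\<^sup>2"
      by (simp only: power_mult[symmetric] mult.commute)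
    finally show ?thesis by simp
  qed
  \<comment> \<open>\<open>phi\<close> distributes the exponents among the coordinates, each coordinate receiving infinitely
    many; so at each exponent only one coordinate contributes and no cancellation can occur.\<close>
  define phi :: "nat \<Rightarrow> 'n" where "phi k = from_nat (fst (prod_decode k))" for k
  have phi_inf: "\<exists>k\<ge>N. phi k = i" for i N
    using le_prod_encode_2[of N "to_nat i"]
    by (intro exI[of _ "prod_encode (to_nat i, N)"]) (simp add: phi_def)
  define a :: "'n \<Rightarrow> nat \<Rightarrow> complex" where
    "a i m = (if \<exists>k. m = M k \<and> phi k = i then of_real (s m) else 0)" for i m
  show ?thesis
  proof (rule that)
    fix i :: 'n and y :: complex
    \<comment> \<open>For k \<ge> K the quotient |y|/(k+1) is at most 1/2, so the terms from degree
      \<open>M K\<close> on are dominated by a geometric series.\<close>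
    obtain K :: nat where K: "2 * cmod y \<le> real K"
      using real_arch_simple by blast
    show "summable (\<lambda>m. a i m * y ^ m)"
    proof (rule summable_comparison_test')
      show "summable (\<lambda>m. (1 / 2 :: real) ^ m)" by simp
      fix m assume m: "m \<ge> M K"
      show "norm (a i m * y ^ m) \<le> (1 / 2) ^ m"
      proof (cases "\<exists>k. m = M k \<and> phi k = i")
        case True
        then obtain k where k: "m = M k" by blast
        then have "k \<ge> K" using m M(1) by (simp add: strict_mono_less_eq)
        then have "2 * cmod y \<le> real (Suc k)" using K by simp
        then have le: "1 / real (Suc k) * cmod y \<le> 1 / 2" by (simp add: field_simps)
        have "norm (a i m * y ^ m) = s m * cmod y ^ m"
          using True s_pos[of k] k by (simp add: a_def norm_mult norm_power)
        also have "\<dots> \<le> (1 / real (Suc k)) ^ m * cmod y ^ m"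
          unfolding k by (intro mult_right_mono s_small) simp
        also have "\<dots> = (1 / real (Suc k) * cmod y) ^ m"
          by (simp only: power_mult_distrib)
        also have "\<dots> \<le> (1 / 2) ^ m"
          by (intro power_mono le) simp
        finally show ?thesis .
      next
        case False
        then have "a i m = 0" unfolding a_def by (rule if_not_P)
        then show ?thesis by simp
      qed
    qed
  next
    have "m \<noteq> M k" if "m < 2" for m k
      using M2[of k] that by simp
    then have "a i m = 0" if "m < 2" for i m
      using that unfolding a_def by auto
    then show "a i 0 = 0" "a i 1 = 0" for i
      by simp_all
  next
    fix z :: "'n \<Rightarrow> complex" and C
    assume bound: "\<forall>m. cmod (\<Sum>i\<in>UNIV. a i m * z i ^ m) \<le> C * cmod (l ^ m - 1)"
    show "z = (\<lambda>_. 0)"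
    proof (rule ccontr)
      assume "z \<noteq> (\<lambda>_. 0)"
      then obtain i where i: "z i \<noteq> 0" by auto
      \<comment> \<open>Cancelling one factor \<open>s (M k)\<close> in the bound will give (|z i|
        (k+1))^(M k) \<le> C. \<open>N1\<close> makes the base at least 2, and \<open>N2\<close>
        makes 2^(M k) exceed C, because \<open>M k\<close> \<ge> k.\<close>
      obtain N1 :: nat where N1: "2 / cmod (z i) \<le> real N1" using real_arch_simple by blast
      obtain N2 :: nat where N2: "C < 2 ^ N2" using real_arch_pow[of 2 C] by auto
      obtain k where k: "k \<ge> max N1 N2" "phi k = i" using phi_inf by blast
      have "(\<Sum>j\<in>UNIV. a j (M k) * z j ^ M k)
          = (\<Sum>j\<in>UNIV. if j = i then of_real (s (M k)) * z i ^ M k else 0)"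
        using k by (intro sum.cong refl) (auto simp: a_def M_inj)
      then have "s (M k) * cmod (z i) ^ M k \<le> C * (s (M k) * s (M k))"
        using bound[rule_format, of "M k"] s_pos[of k] by (simp add: norm_mult norm_power s_sq)
      then have *: "cmod (z i) ^ M k \<le> C * s (M k)"
        using s_pos[of k] by (simp add: mult.assoc mult.left_commute)
      moreover have "0 < cmod (z i) ^ M k"
        using i by simp
      \<comment> \<open>\<open>C\<close> is an arbitrary real; the sign needed to multiply
        \<open>s_small\<close> by it is read off from the bound itself.\<close>
      ultimately have "0 < C * s (M k)"
        by linarith
      then have "C > 0"
        using s_pos[of k] by (simp add: zero_less_mult_iff)
      then have "C * s (M k) \<le> C * (1 / real (Suc k)) ^ M k"
        by (intro mult_left_mono s_small) simp
      with * have "cmod (z i) ^ M k \<le> C * (1 / real (Suc k)) ^ M k"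
        by (rule order_trans)
      then have "(cmod (z i) * real (Suc k)) ^ M k \<le> C"
        by (simp add: power_mult_distrib power_divide field_simps del: of_nat_Suc)
      moreover have "2 \<le> cmod (z i) * real (Suc k)"
      proof -
        have "2 / cmod (z i) \<le> real (Suc k)" using N1 k by simp
        then show ?thesis using i by (simp add: field_simps)
      qed
      then have "2 ^ M k \<le> (cmod (z i) * real (Suc k)) ^ M k"
        by (intro power_mono) auto
      moreover have "(2::real) ^ N2 \<le> 2 ^ M k"
        using k Mk[of k] by (intro power_increasing) auto
      ultimately show False using N2 by linarith
    qed
  qed
qed

section \<open>The skew product, its Jacobian and its inverse\<close>

definition skew :: "complex \<Rightarrow> ('n::finite \<Rightarrow> nat \<Rightarrow> complex) \<Rightarrow> complex ^ ('n + 1) \<Rightarrow> complex ^ ('n + 1)"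
  where "skew u a z = (\<chi> r. case r of Inl i \<Rightarrow> u * z $ Inl i
           | Inr _ \<Rightarrow> z $ Inr 1 + (\<Sum>i\<in>UNIV. \<Sum>m. a i m * (z $ Inl i) ^ m))"

text \<open>The Jacobian is an explicit complex matrix because \<open>holomorphic_map_on\<close>
  expresses complex linearity through one.\<close>

definition skew_deriv ::
  "complex \<Rightarrow> ('n::finite \<Rightarrow> nat \<Rightarrow> complex) \<Rightarrow> complex ^ ('n + 1) \<Rightarrow> complex ^ ('n + 1) ^ ('n + 1)"
  where "skew_deriv u a z = (\<chi> r s. case r of
             Inl i \<Rightarrow> (case s of Inl j \<Rightarrow> if i = j then u else 0 | Inr _ \<Rightarrow> 0)
           | Inr _ \<Rightarrow> (case s of Inl j \<Rightarrow> \<Sum>m. diffs (a j) m * (z $ Inl j) ^ m | Inr _ \<Rightarrow> 1))"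

lemma UNIV_plus_1: "UNIV = (UNIV :: 'n set) <+> {1 :: 1}"
  using UNIV_Plus_UNIV[where 'a = 'n and 'b = 1] by (metis UNIV_eq_I insertI1 num1_eq1)

lemma sum_UNIV_plus_1:
  fixes f :: "'n::finite + 1 \<Rightarrow> 'b::comm_monoid_add"
  shows "(\<Sum>r\<in>UNIV. f r) = (\<Sum>i\<in>UNIV. f (Inl i)) + f (Inr 1)"
  by (simp add: UNIV_plus_1 sum.Plus)

lemma skew_nth [simp]:
  "skew u a z $ Inl i = u * z $ Inl i"
  "skew u a z $ Inr j = z $ Inr 1 + (\<Sum>i\<in>UNIV. \<Sum>m. a i m * (z $ Inl i) ^ m)"
  by (simp_all add: skew_def)

lemma vec_eq_plus_1_iff:
  fixes x y :: "'b ^ ('n::finite + 1)"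
  shows "x = y \<longleftrightarrow> (\<forall>i. x $ Inl i = y $ Inl i) \<and> x $ Inr 1 = y $ Inr 1"
  unfolding vec_eq_iff by (metis (full_types) num1_eq1 sum.exhaust)

text \<open>Each vector of the real basis is supported at a single index r, so the corresponding
  real component depends only on the r-th complex coordinate.\<close>

lemma has_derivative_vecI:
  fixes F :: "'a::real_normed_vector \<Rightarrow> complex ^ 'm::finite"
  assumes "\<And>r. ((\<lambda>x. F x $ r) has_derivative (\<lambda>h. F' h $ r)) (at z)"
  shows "(F has_derivative F') (at z)"
  unfolding has_derivative_componentwise_within[of F]
  by (auto simp: Basis_vec_def inner_axis intro!: has_derivative_inner_left assms)

lemma skew_has_derivative:
  assumes ent: "\<And>i y. summable (\<lambda>m. a i m * y ^ m)"
  shows "(skew u a has_derivative (\<lambda>h. skew_deriv u a z *v h)) (at z)"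
proof (rule has_derivative_vecI)
  fix r :: "'a + 1"
  have nth: "((\<lambda>x. x $ s) has_derivative (\<lambda>h. h $ s)) (at z)" for s
    by (intro bounded_linear_imp_has_derivative bounded_linear_vec_nth)
  show "((\<lambda>x. skew u a x $ r) has_derivative (\<lambda>h. (skew_deriv u a z *v h) $ r)) (at z)"
  proof (cases r)
    case (Inl i)
    have "(\<lambda>h. (skew_deriv u a z *v h) $ r) = (\<lambda>h. u * h $ Inl i)"
      by (simp add: fun_eq_iff Inl matrix_vector_mult_def skew_deriv_def sum_UNIV_plus_1
          if_distrib[of "\<lambda>t. t * _"] cong: if_cong)
    then show ?thesis
      using Inl has_derivative_mult_right[OF nth] by simp
  next
    case (Inr j)
    have "(\<lambda>h. (skew_deriv u a z *v h) $ r)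
        = (\<lambda>h. h $ Inr 1 + (\<Sum>i\<in>UNIV. (\<Sum>m. diffs (a i) m * (z $ Inl i) ^ m) * h $ Inl i))"
      by (simp add: fun_eq_iff Inr matrix_vector_mult_def skew_deriv_def sum_UNIV_plus_1)
    moreover have "((\<lambda>x. \<Sum>m. a i m * (x $ Inl i) ^ m) has_derivative
        (\<lambda>h. (\<Sum>m. diffs (a i) m * (z $ Inl i) ^ m) * h $ Inl i)) (at z)" for i
      using has_derivative_compose[OF nth
        termdiffs_strong_converges_everywhere[OF ent, unfolded has_field_derivative_def]] .
    ultimately show ?thesis
      using Inr by (auto intro!: derivative_intros nth)
  qed
qed

text \<open>Undoing (x, w) -> (u x, w + g x) sends (x, w) to (v x, w - g (v x)), and substituting v
  x multiplies the m-th coefficient by v^m. The inverse thus stays in the same family, so one result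
  on forward orbits also covers backward orbits.\<close>

lemma skew_skew_inverse:
  assumes "u * v = 1" and "\<And>i y. summable (\<lambda>m. a i m * y ^ m)"
  shows "skew v (\<lambda>i m. - a i m * v ^ m) (skew u a z) = z"
proof -
  have "- a i m * v ^ m * (u * x) ^ m = - (a i m * x ^ m)" for i m x
  proof -
    have "v ^ m * u ^ m = 1"
      using assms(1) by (simp add: mult.commute flip: power_mult_distrib)
    then show ?thesis
      by (simp add: power_mult_distrib mult.left_commute[of _ "u ^ m"] mult.assoc[symmetric])
  qed
  then have "(\<Sum>m. - a i m * v ^ m * (u * x) ^ m) = - (\<Sum>m. a i m * x ^ m)" for i x
    by (simp only: suminf_minus[OF assms(2)])
  moreover have "v * (u * x) = x" for x
    using assms(1) by (simp add: mult.commute[of v] mult.left_commute[of v] flip: mult.assoc)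
  ultimately show ?thesis
    by (simp add: vec_eq_plus_1_iff sum_negf)
qed

section \<open>Finiteness of forward orbits\<close>

lemma skew_funpow_Inl: "((skew u a ^^ k) z) $ Inl i = u ^ k * z $ Inl i"
  by (induction k) auto

lemma finite_pos_orbit_if_leaves:
  assumes "(F ^^ k) p \<notin> A"
  shows "finite (pos_orbit F A p)"
proof (rule finite_subset)
  show "pos_orbit F A p \<subseteq> (\<lambda>j. (F ^^ j) p) ` {..<k}"
    using assms by (force simp: pos_orbit_def not_le[symmetric])
qed simp

lemma finite_pos_orbit_fixpoint:
  assumes "F p = p"
  shows "finite (pos_orbit F A p)"
proof (rule finite_subset)
  have "(F ^^ j) p = p" for j using assms by (induction j) auto
  then show "pos_orbit F A p \<subseteq> {p}" by (auto simp: pos_orbit_def)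
qed simp

lemma finite_pos_orbit_skew:
  fixes a :: "'n::finite \<Rightarrow> nat \<Rightarrow> complex"
  assumes u: "cmod u = 1" and nr: "\<And>m. m \<ge> 1 \<Longrightarrow> u ^ m \<noteq> 1"
    and ent: "\<And>i y. summable (\<lambda>m. a i m * y ^ m)" and a0: "\<And>i. a i 0 = 0"
    and large: "\<And>z C. \<forall>m. cmod (\<Sum>i\<in>UNIV. a i m * z i ^ m) \<le> C * cmod (u ^ m - 1) \<Longrightarrow> z = (\<lambda>_. 0)"
    and U: "bounded U"
  shows "finite (pos_orbit (skew u a) (cart_prod UNIV U) p)"
proof (cases "\<forall>k. (skew u a ^^ k) p \<in> cart_prod UNIV U")
  case False
  then show ?thesis by (blast intro: finite_pos_orbit_if_leaves)
next
  case True
  define W where "W k = (skew u a ^^ k) p $ Inr 1" for k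
  \<comment> \<open>All base coordinates rotate by the same \<open>u\<close>, so their degree m
    terms merge into one coefficient, multiplied by (u^k)^m at the k-th iterate.\<close>
  define G where "G m = (\<Sum>i\<in>UNIV. a i m * (p $ Inl i) ^ m)" for m
  obtain C where C: "\<And>w. w \<in> U \<Longrightarrow> cmod w \<le> C"
    using U by (auto simp: bounded_iff)
  have bd: "cmod (W k) \<le> C" for k
    using True C by (auto simp: W_def cart_prod_def)
  \<comment> \<open>Convergence at the larger radius |y| + 1 gives absolute convergence at
    y.\<close>
  have abs: "summable (\<lambda>m. cmod (a i m * y ^ m))" for i y
    using powser_insidea[OF ent, of y "of_real (cmod y + 1)"] by simp
  have sm: "summable (\<lambda>m. cmod (G m))"
  proof (rule summable_comparison_test')
    show "summable (\<lambda>m. \<Sum>i\<in>UNIV. cmod (a i m * (p $ Inl i) ^ m))"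
      by (intro summable_sum abs)
    show "norm (cmod (G m)) \<le> (\<Sum>i\<in>UNIV. cmod (a i m * (p $ Inl i) ^ m))" for m
      by (simp add: G_def norm_sum)
  qed
  have rec: "W (Suc k) - W k = (\<Sum>m. G m * (u ^ k) ^ m)" for k
  proof -
    have "W (Suc k) - W k = (\<Sum>i\<in>UNIV. \<Sum>m. a i m * (u ^ k * p $ Inl i) ^ m)"
      by (simp add: W_def skew_funpow_Inl)
    also have "\<dots> = (\<Sum>m. \<Sum>i\<in>UNIV. a i m * (u ^ k * p $ Inl i) ^ m)"
      by (intro suminf_sum[symmetric] ent)
    also have "\<dots> = (\<Sum>m. G m * (u ^ k) ^ m)"
      by (simp add: G_def sum_distrib_left power_mult_distrib mult_ac)
    finally show ?thesis .
  qed
  have "\<forall>m. cmod (\<Sum>i\<in>UNIV. a i m * (p $ Inl i) ^ m) \<le> C * cmod (u ^ m - 1)"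
    using bounded_birkhoff_sums_coeff_bound[OF u nr sm rec bd] by (simp add: G_def)
  then have "(\<lambda>i. p $ Inl i) = (\<lambda>_. 0)"
    by (rule large)
  \<comment> \<open>With all base coordinates 0 only the constant terms of the series remain, and
    these vanish.\<close>
  then have "skew u a p = p"
    by (simp add: vec_eq_plus_1_iff fun_eq_iff a0 powser_zero)
  then show ?thesis by (rule finite_pos_orbit_fixpoint)
qed

section \<open>The differential at the origin and diagonal matrices\<close>

lemma skew_deriv_0:
  assumes "\<And>i. a i 1 = 0"
  shows "skew_deriv u a 0 = (\<chi> r s. if r = s then (case r of Inl _ \<Rightarrow> u | Inr _ \<Rightarrow> 1) else 0)"
  using assms by (auto simp: skew_deriv_def vec_eq_iff powser_zero diffs_def split: sum.splits)

lemma diagonal_matrix_vector_mult: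
  "((\<chi> r s. if r = s then d r else 0) *v x) $ i = d i * x $ i" for x :: "complex ^ 'm::finite"
  by (simp add: matrix_vector_mult_def if_distrib[of "\<lambda>t. t * _"] cong: if_cong)

lemma spectrum_op_diagonal:
  "spectrum_op (\<lambda>h :: complex ^ 'm::finite. (\<chi> r s. if r = s then d r else 0) *v h) = range d"
proof (intro set_eqI iffI)
  fix c assume "c \<in> spectrum_op (\<lambda>h :: complex ^ 'm. (\<chi> r s. if r = s then d r else 0) *v h)"
  then obtain v :: "complex ^ 'm" where v: "v \<noteq> 0"
    and eq: "(\<chi> r s. if r = s then d r else 0) *v v = c *s v"
    by (auto simp: spectrum_op_def)
  obtain i where i: "v $ i \<noteq> 0" using v by (auto simp: vec_eq_iff)
  have "d i * v $ i = c * v $ i"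
    using arg_cong[OF eq, of "\<lambda>x. x $ i"] by (simp only: diagonal_matrix_vector_mult vector_smult_component)
  then show "c \<in> range d" using i by auto
next
  fix c assume "c \<in> range d"
  then obtain i where i: "c = d i" by blast
  have "(\<chi> r s. if r = s then d r else 0) *v axis i 1 = c *s (axis i 1 :: complex ^ 'm)"
    by (simp add: vec_eq_iff diagonal_matrix_vector_mult i axis_def)
  moreover have "axis i 1 \<noteq> (0 :: complex ^ 'm)" by (simp add: axis_eq_0_iff)
  ultimately show "c \<in> spectrum_op (\<lambda>h :: complex ^ 'm. (\<chi> r s. if r = s then d r else 0) *v h)"
    unfolding spectrum_op_def by blast
qed

lemma charpoly_diagonal:
  "charpoly (\<chi> r s. if r = s then d r else 0) = (\<Prod>r\<in>(UNIV :: 'm::finite set). [:- d r, 1:])"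
  unfolding charpoly_def by (subst det_diagonal) auto

section \<open>Construction of the biholomorphism\<close>

theorem theorem1:
  fixes l :: complex
  assumes "cremer_number l"
  shows "\<exists>F :: complex ^ ('n::finite + 1) \<Rightarrow> complex ^ ('n + 1).
           biholomorphism F UNIV UNIV \<and> F 0 = 0 \<and>
           spectrum_op (frechet_derivative F (at 0)) = {l, 1} \<and>
           alg_multiplicity (frechet_derivative F (at 0)) 1 = 1 \<and>
           (\<forall>U :: complex set. open U \<and> bounded U \<longrightarrow>
              finite_orbits_property UNIV F (cart_prod (UNIV :: (complex ^ 'n) set) U))"
proof -
  have l1: "cmod l = 1" and nr: "\<And>m. m \<ge> 1 \<Longrightarrow> l ^ m \<noteq> 1"
    using assms by (auto simp: cremer_number_def)
  have l0: "l \<noteq> 0" and l_ne_1: "l \<noteq> 1" using l1 nr[of 1] by auto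
  obtain a :: "'n \<Rightarrow> nat \<Rightarrow> complex" where ent: "\<And>i y. summable (\<lambda>m. a i m * y ^ m)"
    and a0: "\<And>i. a i 0 = 0" and a1: "\<And>i. a i 1 = 0"
    and large: "\<And>z C. \<forall>m. cmod (\<Sum>i\<in>UNIV. a i m * z i ^ m) \<le> C * cmod (l ^ m - 1) \<Longrightarrow> z = (\<lambda>_. 0)"
    by (rule cremer_number_lacunary_coefficients[OF assms, where 'n = 'n]) (rule that; assumption)
  define v where "v = inverse l"
  define b where "b = (\<lambda>i m. - a i m * v ^ m)"
  define F where "F = skew l a"
  have v1: "cmod v = 1" using l1 by (simp add: v_def norm_inverse)
  have lv: "l * v = 1" "v * l = 1" using l0 by (auto simp: v_def)
  have nrv: "v ^ m \<noteq> 1" if "m \<ge> 1" for m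
    using nr[OF that] by (simp add: v_def power_inverse)
  have entb: "summable (\<lambda>m. b i m * y ^ m)" for i y
    using summable_minus[OF ent[of i "v * y"]] by (simp add: b_def power_mult_distrib mult_ac)
  \<comment> \<open>Twisting the coefficients a second time restores \<open>a\<close>, so the
    one-sided inverse formula also yields the other side.\<close>
  have a_eq: "(\<lambda>i m. - b i m * l ^ m) = a"
    using lv by (simp add: b_def fun_eq_iff mult.assoc flip: power_mult_distrib)
  have left: "skew v b (F z) = z" for z
    unfolding F_def b_def by (rule skew_skew_inverse[OF lv(1) ent])
  have right: "F (skew v b z) = z" for z
    using skew_skew_inverse[OF lv(2), of b z] entb unfolding a_eq F_def by blast
  have bij: "bij F" by (rule o_bij[of "skew v b"]) (auto simp: left right)
  have inv: "inv F = skew v b"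
    by (rule inv_unique_comp) (auto simp: left right)
  \<comment> \<open>The numbers l and 1/l have equal small divisors, and \<open>b i m\<close>
    differs from \<open>a i m\<close> by a unimodular factor independent of i; hence
    \<open>large\<close> carries over to the inverse.\<close>
  have norm_v: "cmod (v ^ m - 1) = cmod (l ^ m - 1)" for m
  proof -
    have "v ^ m - 1 = - (v ^ m * (l ^ m - 1))"
      using lv by (simp add: algebra_simps flip: power_mult_distrib)
    then show ?thesis using v1 by (simp add: norm_mult norm_power)
  qed
  have largeb: "z = (\<lambda>_. 0)"
    if z: "\<forall>m. cmod (\<Sum>i\<in>UNIV. b i m * z i ^ m) \<le> C * cmod (v ^ m - 1)" for z C
  proof (rule large[of _ C], rule allI)
    fix m
    have "(\<Sum>i\<in>UNIV. b i m * z i ^ m) = - (v ^ m * (\<Sum>i\<in>UNIV. a i m * z i ^ m))"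
      by (simp add: b_def sum_distrib_left sum_negf mult_ac)
    then show "cmod (\<Sum>i\<in>UNIV. a i m * z i ^ m) \<le> C * cmod (l ^ m - 1)"
      using z[rule_format, of m] v1 by (simp add: norm_mult norm_power norm_v)
  qed
  have "biholomorphism F UNIV UNIV"
    unfolding biholomorphism_def holomorphic_map_on_def inv
    using bij skew_has_derivative[of a l, OF ent] skew_has_derivative[of b v, OF entb]
    by (simp add: F_def) blast
  moreover have "F 0 = 0"
    by (simp add: F_def vec_eq_plus_1_iff powser_zero a0)
  moreover define d :: "'n + 1 \<Rightarrow> complex" where "d r = (case r of Inl _ \<Rightarrow> l | Inr _ \<Rightarrow> 1)" for r
  have D: "frechet_derivative F (at 0) = (\<lambda>h. (\<chi> r s. if r = s then d r else 0) *v h)"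
    unfolding F_def d_def skew_deriv_0[of a l, OF a1, symmetric]
    by (rule frechet_derivative_at[OF skew_has_derivative[of a l, OF ent], symmetric])
  have "range d = {l, 1}"
    by (auto simp: d_def image_iff split: sum.splits)
  then have "spectrum_op (frechet_derivative F (at 0)) = {l, 1}"
    unfolding D spectrum_op_diagonal .
  moreover have "alg_multiplicity (frechet_derivative F (at 0)) 1 = 1"
  proof -
    \<comment> \<open>Only the last coordinate contributes a root 1, since l is not 1.\<close>
    have "charpoly (matrix (frechet_derivative F (at 0))) = [:- l, 1:] ^ CARD('n) * [:- 1, 1:]"
      unfolding D matrix_of_matrix_vector_mul charpoly_diagonal
      by (simp add: UNIV_plus_1 prod.Plus d_def)
    moreover have "order 1 ([:- l, 1:] ^ CARD('n)) = 0"
      using l_ne_1 by (intro order_0I) simp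
    moreover have "order 1 [:- 1, 1 :: complex:] = 1"
      using order_power_n_n[of "1::complex" 1] by simp
    ultimately show ?thesis
      by (simp add: alg_multiplicity_def order_mult del: mult_pCons_right)
  qed
  moreover have "finite_orbits_property UNIV F (cart_prod (UNIV :: (complex ^ 'n) set) U)"
    if "bounded U" for U
    unfolding finite_orbits_property_def full_orbit_def neg_orbit_def inv
    using finite_pos_orbit_skew[of l a, OF l1 nr ent a0 large that]
      finite_pos_orbit_skew[of v b, OF v1 nrv entb _ largeb that]
    by (simp add: F_def b_def a0)
  ultimately show ?thesis by blast
qed

end
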